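(* Let $\vec G$ be a strongly connected directed graph with vertices $v_0,\dots,v_n$ and let $D$ be a divisor with $D(v)\ge0$ for all $v\in V(\vec G)\setminus\{v_0\}$. Let $f_0,f_1,\dots$ be the sequence of firing strategies output by the generalized Dhar's Algorithm on $D$. Then: (i) the divisor $D$ is $v_0$-reduced if and only if the generalized Dhar's Algorithm terminates at $f_{\vec 1\cdot R}=\vec 0$; (ii) if $D$ is a $v_0$-reduced divisor, then for each $0\le t\le\vec 1\cdot R-1$ such that $f_{t+1}=f_t-\chi_{\{v_0\}}$, the divisor $D-\vec Q^Tf_t$ is $v_0$-reduced.
   Context: Directed graphs are finite, without loops, possibly with multiple edges. The Laplacian is $\vec Q=\mathrm{diag}(\deg^+(v_0),\dots,\deg^+(v_n))-\vec A$, with $\vec A_{i,j}$ the number of edges from $v_i$ to $v_j$ and $\deg^+$ the out-degree. $R=(r_0,\dots,r_n)$ is the vector of positive integers with $\gcd(r_0,\dots,r_n)=1$ and $\vec Q^TR=\vec 0$ (it exists and is unique since $\vec G$ is strongly connected). Divisors and firing strategies are vectors in $\mathbb Z^{n+1}$, indexed by vertices; $\vec 0,\vec1$ are the all-zeros and all-ones vectors; $\chi_{\{v\}}$ is the standard basis vector of $v$; inequalities are coordinatewise. A nonzero $f\in\mathbb Z^{n+1}$ is a valid firing strategy with respect to $v_0$ if $f(v_0)=0$ and $\vec 0\le f\le R$. A divisor $D$ is $v_0$-reduced if $D(v)\ge0$ for all $v\ne v_0$ and for every valid firing strategy $f$ with respect to $v_0$ there is a vertex $v\ne v_0$ with $(D-\vec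 Q^Tf)(v)<0$. Generalized Dhar's Algorithm, on input $D$ with $D(v)\ge0$ for all $v\ne v_0$: set $f_0=R$. For $t\ge0$: if there is some $v\ne v_0$ with $(D-\vec Q^Tf_t)(v)\le-1$, pick one such $v$ and set $f_{t+1}=f_t-\chi_{\{v\}}$. If $(D-\vec Q^Tf_t)(v)\ge0$ for all $v\ne v_0$ and $f_t(v_0)>0$, set $f_{t+1}=f_t-\chi_{\{v_0\}}$. Otherwise the algorithm terminates, and the output is the decreasing sequence of the $f_t$. *)

theory Defs
  imports
    "Graph_Theory.Digraph_Component"
    "HOL-Library.Extended_Nat"
    "HOL-Library.Indicator_Function"
begin

text \<open>
  Integer vectors indexed by the vertices of \<open>G\<close> are functions \<open>'a \<Rightarrow> int\<close> of which only the
  values on \<^term>\<open>verts G\<close> matter; every (in)equality between such vectors is therefore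
  stated pointwise on \<^term>\<open>verts G\<close>.
\<close>

definition edge_mult :: "('a, 'b) pre_digraph \<Rightarrow> 'a \<Rightarrow> 'a \<Rightarrow> nat" where
  "edge_mult G u v = card {e \<in> arcs G. tail G e = u \<and> head G e = v}"

definition laplacian :: "('a, 'b) pre_digraph \<Rightarrow> 'a \<Rightarrow> 'a \<Rightarrow> int" where
  "laplacian G u v = (if u = v then int (out_degree G u) else 0) - int (edge_mult G u v)"

text \<open>The matrix-vector product \<open>Q\<^sup>T f\<close>.\<close>

definition laplacian_T :: "('a, 'b) pre_digraph \<Rightarrow> ('a \<Rightarrow> int) \<Rightarrow> 'a \<Rightarrow> int" where
  "laplacian_T G f v = (\<Sum>u\<in>verts G. laplacian G u v * f u)"

text \<open>
  If \<open>G\<close> is finite and strongly connected, exactly one vector (up to its values outside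
  \<^term>\<open>verts G\<close>) satisfies the following predicate.
\<close>

definition primitive_kernel_vector :: "('a, 'b) pre_digraph \<Rightarrow> ('a \<Rightarrow> int) \<Rightarrow> bool" where
  "primitive_kernel_vector G R \<longleftrightarrow>
     (\<forall>v\<in>verts G. R v > 0) \<and> Gcd (R ` verts G) = 1 \<and> (\<forall>v\<in>verts G. laplacian_T G R v = 0)"

definition valid_firing ::
  "('a, 'b) pre_digraph \<Rightarrow> 'a \<Rightarrow> ('a \<Rightarrow> int) \<Rightarrow> ('a \<Rightarrow> int) \<Rightarrow> bool" where
  "valid_firing G v0 R f \<longleftrightarrow>
     (\<exists>v\<in>verts G. f v \<noteq> 0) \<and> f v0 = 0 \<and> (\<forall>v\<in>verts G. 0 \<le> f v \<and> f v \<le> R v)"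

definition reduced ::
  "('a, 'b) pre_digraph \<Rightarrow> 'a \<Rightarrow> ('a \<Rightarrow> int) \<Rightarrow> ('a \<Rightarrow> int) \<Rightarrow> bool" where
  "reduced G v0 R D \<longleftrightarrow>
     (\<forall>v\<in>verts G - {v0}. D v \<ge> 0) \<and>
     (\<forall>f. valid_firing G v0 R f \<longrightarrow> (\<exists>v\<in>verts G - {v0}. (D - laplacian_T G f) v < 0))"

text \<open>
  One iteration of the generalized Dhar algorithm. It is a relation because the vertex to be
  decreased in the first case is chosen arbitrarily.
\<close>

inductive dhar_step ::
  "('a, 'b) pre_digraph \<Rightarrow> 'a \<Rightarrow> ('a \<Rightarrow> int) \<Rightarrow> ('a \<Rightarrow> int) \<Rightarrow> ('a \<Rightarrow> int) \<Rightarrow> bool"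
  for G v0 D where
  nonroot: "v \<in> verts G - {v0} \<Longrightarrow> (D - laplacian_T G f) v \<le> -1 \<Longrightarrow>
      dhar_step G v0 D f (f - indicator {v})"
| root: "\<forall>v\<in>verts G - {v0}. (D - laplacian_T G f) v \<ge> 0 \<Longrightarrow> f v0 > 0 \<Longrightarrow>
      dhar_step G v0 D f (f - indicator {v0})"

text \<open>
  \<open>dhar_run G v0 R D f N\<close>: some execution of the algorithm produces exactly the strategies
  \<open>f t\<close> with \<open>t \<le> N\<close>. The case \<open>N = \<infinity>\<close> is an execution that never terminates, so
  termination is not built into the definition. The values \<open>f t\<close> for \<open>t > N\<close> are irrelevant.
\<close>

definition dhar_run ::
  "('a, 'b) pre_digraph \<Rightarrow> 'a \<Rightarrow> ('a \<Rightarrow> int) \<Rightarrow> ('a \<Rightarrow> int) \<Rightarrow> (nat \<Rightarrow> 'a \<Rightarrow> int) \<Rightarrow> enat \<Rightarrow> bool"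
  where
  "dhar_run G v0 R D f N \<longleftrightarrow>
     f 0 = R \<and>
     (\<forall>t. enat t < N \<longrightarrow> dhar_step G v0 D (f t) (f (Suc t))) \<and>
     (\<forall>T. N = enat T \<longrightarrow> (\<nexists>g. dhar_step G v0 D (f T) g))"

end

theory Submission
  imports Defs
begin

text \<open>
  Off-diagonal Laplacian entries are nonpositive, so raising \<open>f\<close> at other vertices can only
  increase \<open>(D - Q\<^sup>T f) v\<close>. Hence the algorithm never falls below a strategy \<open>g\<close> for which
  \<open>D - Q\<^sup>T g \<ge> 0\<close> off \<open>v\<^sub>0\<close>, as long as it does not do so at \<open>v\<^sub>0\<close>. With \<open>g = 0\<close> this gives
  nonnegativity and termination; with \<open>g\<close> a valid strategy that certifies non-reducedness it
  gives (i).

  For (ii), let \<open>g\<close> certify that \<open>D - Q\<^sup>T f\<^sub>t\<close> is not reduced and put \<open>k = f\<^sub>t + g\<close>, which may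
  exceed \<open>R\<close>. Since \<open>Q\<^sup>T R = 0\<close> and strategies with \<open>D - Q\<^sup>T h \<ge> 0\<close> off \<open>v\<^sub>0\<close> are closed under
  maxima, \<open>max (k - R) 0\<close> is such a strategy; \<open>D\<close> being reduced, it vanishes, that is, \<open>k \<le> R\<close>.
  Then \<open>k\<close> is a lower bound for the first \<open>t\<close> steps, so \<open>f\<^sub>t + g \<le> f\<^sub>t\<close>, a contradiction.
\<close>

section \<open>Monotonicity of the Laplacian\<close>

lemma laplacian_T_antimono:
  assumes "\<And>u. u \<in> verts G \<Longrightarrow> g u \<le> h u" and "g v = h v"
  shows "laplacian_T G h v \<le> laplacian_T G g v"
  unfolding laplacian_T_def
proof (rule sum_mono)
  fix u assume u: "u \<in> verts G"
  show "laplacian G u v * h u \<le> laplacian G u v * g u"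
  proof (cases "u = v")
    \<comment> \<open>Only the diagonal coefficient can be positive, and there \<open>g\<close> and
      \<open>h\<close> agree.\<close>
    case True
    then show ?thesis using assms(2) by simp
  next
    case False
    then have "laplacian G u v \<le> 0" by (simp add: laplacian_def)
    then show ?thesis using assms(1)[OF u] by (rule mult_left_mono_neg[rotated])
  qed
qed

lemma laplacian_T_zero [simp]: "laplacian_T G (\<lambda>_. 0) v = 0"
  by (simp add: laplacian_T_def)

lemma laplacian_T_add: "laplacian_T G (\<lambda>u. g u + h u) v = laplacian_T G g v + laplacian_T G h v"
  by (simp add: laplacian_T_def distrib_left sum.distrib)

lemma laplacian_T_diff: "laplacian_T G (\<lambda>u. g u - h u) v = laplacian_T G g v - laplacian_T G h v"
  by (simp add: laplacian_T_def right_diff_distrib sum_subtractf)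

lemma laplacian_T_nonpos:
  assumes "\<And>u. u \<in> verts G \<Longrightarrow> 0 \<le> g u" and "g v = 0"
  shows "laplacian_T G g v \<le> 0"
  using laplacian_T_antimono[of G "\<lambda>_. 0" g v] assms by simp

section \<open>Single steps of the algorithm\<close>

lemma dhar_step_bounded_below:
  assumes step: "dhar_step G v0 D f f'"
    and ge: "\<And>u. u \<in> verts G \<Longrightarrow> g u \<le> f u"
    and legal: "\<And>v. v \<in> verts G - {v0} \<Longrightarrow> 0 \<le> D v - laplacian_T G g v"
    and root: "g v0 \<le> f' v0"
    and u: "u \<in> verts G"
  shows "g u \<le> f' u"
  using step
proof cases
  case (nonroot v)
  \<comment> \<open>If \<open>g\<close> met \<open>f\<close> at \<open>v\<close>, monotonicity would
    carry nonnegativity at \<open>v\<close> over from \<open>g\<close> to \<open>f\<close>, so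
    \<open>v\<close> would not be decremented. By integrality there is room for one
    decrement.\<close>
  have "g v \<noteq> f v"
  proof
    assume "g v = f v"
    then have "laplacian_T G f v \<le> laplacian_T G g v"
      using ge by (intro laplacian_T_antimono) auto
    then show False using nonroot(3) legal[OF nonroot(2)] by simp
  qed
  moreover have "g v \<le> f v" using ge nonroot(2) by simp
  ultimately show ?thesis using ge[OF u] nonroot(1) by (cases "u = v") auto
next
  case root
  then show ?thesis using ge[OF u] assms(4) by (cases "u = v0") auto
qed

lemma dhar_step_le: "dhar_step G v0 D f f' \<Longrightarrow> f' u \<le> f u"
  by (erule dhar_step.cases) (auto simp: indicator_def)

lemma dhar_step_sum:
  assumes "dhar_step G v0 D f f'" and fin: "finite (verts G)" and v0: "v0 \<in> verts G"
  shows "(\<Sum>u\<in>verts G. f' u) = (\<Sum>u\<in>verts G. f u) - 1"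
proof -
  obtain v where "v \<in> verts G" and "f' = f - indicator {v}"
    using assms(1) v0 by cases auto
  then show ?thesis
    using fin by (simp add: sum_subtractf indicator_def)
qed

text \<open>The result of a step reveals which rule was applied: \<open>nonroot\<close> leaves the
  value at \<open>v0\<close> unchanged.\<close>

lemma dhar_step_root:
  assumes "dhar_step G v0 D f (f - indicator {v0})" and "v \<in> verts G - {v0}"
  shows "0 \<le> D v - laplacian_T G f v"
  using assms(1)
proof cases
  case (nonroot w)
  then have "(f - indicator {v0}) v0 = (f - indicator {w}) v0" by simp
  then show ?thesis using nonroot(2) by (simp add: indicator_def split: if_splits)
next
  case root
  then show ?thesis using assms(2) by simp
qed

lemma dhar_halted:
  assumes "\<nexists>g. dhar_step G v0 D f g"
  shows "f v0 \<le> 0" and "v \<in> verts G - {v0} \<Longrightarrow> 0 \<le> D v - laplacian_T G f v"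
proof -
  have legal: "0 \<le> D v - laplacian_T G f v" if "v \<in> verts G - {v0}" for v
    using dhar_step.nonroot[OF that, of D f] assms by force
  then show "v \<in> verts G - {v0} \<Longrightarrow> 0 \<le> D v - laplacian_T G f v" .
  show "f v0 \<le> 0"
    using dhar_step.root[of G v0 D f] legal assms by force
qed

lemma not_reducedI:
  assumes "valid_firing G v0 R g"
    and "\<And>v. v \<in> verts G - {v0} \<Longrightarrow> 0 \<le> D v - laplacian_T G g v"
  shows "\<not> reduced G v0 R D"
  using assms unfolding reduced_def by force

section \<open>Bounds along an execution and its termination\<close>

locale dhar_execution = fin_digraph G for G :: "('a, 'b) pre_digraph" +
  fixes v0 :: 'a and R D :: "'a \<Rightarrow> int" and f :: "nat \<Rightarrow> 'a \<Rightarrow> int" and N :: enat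
  assumes v0: "v0 \<in> verts G"
    and R_pos: "\<And>v. v \<in> verts G \<Longrightarrow> 0 < R v"
    and R_kernel: "\<And>v. v \<in> verts G \<Longrightarrow> laplacian_T G R v = 0"
    and D_nonneg: "\<And>v. v \<in> verts G - {v0} \<Longrightarrow> 0 \<le> D v"
    and run: "dhar_run G v0 R D f N"
begin

lemma start: "f 0 = R"
  using run by (simp add: dhar_run_def)

lemma step: "enat t < N \<Longrightarrow> dhar_step G v0 D (f t) (f (Suc t))"
  using run by (simp add: dhar_run_def)

lemma step_before: "enat t \<le> N \<Longrightarrow> s < t \<Longrightarrow> dhar_step G v0 D (f s) (f (Suc s))"
  by (rule step) (metis enat_ord_simps(2) order_less_le_trans)

lemma run_decreasing: "s \<le> t \<Longrightarrow> enat t \<le> N \<Longrightarrow> f t u \<le> f s u"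
proof (induction t rule: dec_induct)
  case (step n)
  have "enat n \<le> N" using step.prems by (meson enat_ord_simps(1) le_SucI order_refl order_trans)
  then show ?case
    using step.IH dhar_step_le[OF step_before[OF step.prems, of n], of u] by force
qed simp

text \<open>Decrements at \<open>v0\<close> are not controlled by \<open>g\<close>, so the bound
  there is a hypothesis. It is applied both with \<open>g v0 = 0\<close> and with
  \<open>g v0 = f T v0\<close>.\<close>

lemma run_bounded_below:
  assumes le_R: "\<And>u. u \<in> verts G \<Longrightarrow> g u \<le> R u"
    and legal: "\<And>v. v \<in> verts G - {v0} \<Longrightarrow> 0 \<le> D v - laplacian_T G g v"
    and T: "enat T \<le> N" and root: "\<And>s. s \<le> T \<Longrightarrow> g v0 \<le> f s v0"
    and u: "u \<in> verts G"
  shows "g u \<le> f T u"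
proof -
  have "t \<le> T \<Longrightarrow> \<forall>u\<in>verts G. g u \<le> f t u" for t
  proof (induction t)
    case 0
    then show ?case using le_R start by simp
  next
    case (Suc t)
    then show ?case
      using dhar_step_bounded_below[OF step_before[OF T, of t], of g] legal root by simp
  qed
  then show ?thesis using u by simp
qed

lemma run_root_nonneg: "enat t \<le> N \<Longrightarrow> 0 \<le> f t v0"
proof (induction t)
  case 0
  then show ?case using R_pos[OF v0] start by simp
next
  case (Suc t)
  have "enat t \<le> N" using Suc.prems by (meson enat_ord_simps(1) le_SucI order_refl order_trans)
  then have "0 \<le> f t v0" by (rule Suc.IH)
  with step_before[OF Suc.prems lessI] show ?case
    by cases (auto simp: indicator_def)
qed

lemma run_root_bounded_below:
  assumes "g v0 = 0" and "enat T \<le> N" and "s \<le> T"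
  shows "g v0 \<le> f s v0"
proof -
  have "enat s \<le> enat T" using assms(3) by simp
  then have "enat s \<le> N" using assms(2) by (rule order_trans)
  then show ?thesis using run_root_nonneg assms(1) by simp
qed

lemma run_nonneg:
  assumes t: "enat t \<le> N" and u: "u \<in> verts G"
  shows "0 \<le> f t u"
proof (rule run_bounded_below[of "\<lambda>_. 0", OF _ _ t _ u])
  show "0 \<le> R u" if "u \<in> verts G" for u
    using R_pos[OF that] by simp
  show "0 \<le> D v - laplacian_T G (\<lambda>_. 0) v" if "v \<in> verts G - {v0}" for v
    using D_nonneg[OF that] by simp
  show "0 \<le> f s v0" if "s \<le> t" for s
    using run_root_bounded_below[of "\<lambda>_. 0", OF refl t that] .
qed

lemma run_le_R: "enat t \<le> N \<Longrightarrow> f t u \<le> R u"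
  using run_decreasing[of 0 t u] start by simp

lemma run_sum: "enat t \<le> N \<Longrightarrow> (\<Sum>u\<in>verts G. f t u) = (\<Sum>u\<in>verts G. R u) - int t"
proof (induction t)
  case 0
  then show ?case using start by simp
next
  case (Suc t)
  have "enat t \<le> N" using Suc.prems by (meson enat_ord_simps(1) le_SucI order_refl order_trans)
  then show ?case
    using Suc.IH dhar_step_sum[OF step_before[OF Suc.prems lessI] finite_verts v0] by simp
qed

lemma terminates:
  obtains T where "N = enat T" and "\<nexists>g. dhar_step G v0 D (f T) g"
proof (cases N)
  case (enat T)
  then show ?thesis using run that by (simp add: dhar_run_def)
next
  case infinity
  \<comment> \<open>The total of the strategy drops by one per step; one step more than the total of
    \<open>R\<close> would make it negative.\<close>
  let ?t = "Suc (nat (\<Sum>u\<in>verts G. R u))"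
  have "enat ?t \<le> N" using infinity by simp
  then have "0 \<le> (\<Sum>u\<in>verts G. f ?t u)"
    by (intro sum_nonneg run_nonneg)
  also have "\<dots> = (\<Sum>u\<in>verts G. R u) - int ?t"
    using \<open>enat ?t \<le> N\<close> by (rule run_sum)
  finally show ?thesis by linarith
qed

section \<open>Reducedness and the final strategy\<close>

lemma reduced_terminates_at_zero:
  assumes red: "reduced G v0 R D"
  shows "N = enat (nat (\<Sum>v\<in>verts G. R v))"
    and "\<forall>v\<in>verts G. f (nat (\<Sum>v\<in>verts G. R v)) v = 0"
proof -
  obtain T where T: "N = enat T" and halted: "\<nexists>g. dhar_step G v0 D (f T) g"
    by (rule terminates)
  have "f T v0 = 0" using dhar_halted(1)[OF halted] run_root_nonneg[of T] T by simp
  \<comment> \<open>A halted strategy leaves no debt off \<open>v0\<close>, so if it were valid it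
    would contradict reducedness.\<close>
  moreover have "\<not> valid_firing G v0 R (f T)"
    using not_reducedI[of G v0 R "f T" D] dhar_halted(2)[OF halted] red by auto
  ultimately have zero: "\<forall>v\<in>verts G. f T v = 0"
    using run_nonneg[of T] run_le_R[of T] T by (auto simp: valid_firing_def)
  then have "(\<Sum>v\<in>verts G. R v) = int T" using run_sum[of T] T by simp
  then have "T = nat (\<Sum>v\<in>verts G. R v)" by simp
  then show "N = enat (nat (\<Sum>v\<in>verts G. R v))"
    and "\<forall>v\<in>verts G. f (nat (\<Sum>v\<in>verts G. R v)) v = 0"
    using T zero by auto
qed

lemma reduced_if_reaches_zero:
  assumes T: "enat T \<le> N" and zero: "\<forall>v\<in>verts G. f T v = 0"
  shows "reduced G v0 R D"
proof (rule ccontr)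
  assume "\<not> reduced G v0 R D"
  then obtain g where valid: "valid_firing G v0 R g"
    and legal: "\<And>v. v \<in> verts G - {v0} \<Longrightarrow> 0 \<le> D v - laplacian_T G g v"
    using D_nonneg unfolding reduced_def by (force simp: not_less)
  have "g u \<le> f T u" if "u \<in> verts G" for u
  proof (rule run_bounded_below[OF _ legal T _ that])
    show "g u \<le> R u" if "u \<in> verts G" for u
      using valid that by (simp add: valid_firing_def)
    show "g v0 \<le> f s v0" if "s \<le> T" for s
      using valid run_root_bounded_below[OF _ T that] by (simp add: valid_firing_def)
  qed
  then show False using valid zero by (force simp: valid_firing_def)
qed

lemma reduced_at_root_step:
  assumes red: "reduced G v0 R D" and t: "enat t < N"
    and root: "f (Suc t) = f t - indicator {v0}"
  shows "reduced G v0 R (D - laplacian_T G (f t))"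
proof (rule ccontr)
  assume nred: "\<not> reduced G v0 R (D - laplacian_T G (f t))"
  have t': "enat t \<le> N" using t by simp
  \<comment> \<open>With nonnegativity settled, reducedness can only fail through some
    \<open>g\<close>.\<close>
  have "0 \<le> D v - laplacian_T G (f t) v" if "v \<in> verts G - {v0}" for v
    using dhar_step_root[OF step[OF t, unfolded root] that] .
  then obtain g where valid: "valid_firing G v0 R g"
    and legal: "\<And>v. v \<in> verts G - {v0} \<Longrightarrow> 0 \<le> D v - laplacian_T G (f t) v - laplacian_T G g v"
    using nred unfolding reduced_def by (force simp: not_less)
  have g_v0: "g v0 = 0" and g_le: "\<And>u. u \<in> verts G \<Longrightarrow> g u \<le> R u"
    using valid by (auto simp: valid_firing_def)
  let ?k = "\<lambda>u. f t u + g u"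
  define h where "h u = max (?k u - R u) 0" for u
  have k_legal: "0 \<le> D v - laplacian_T G ?k v" if "v \<in> verts G - {v0}" for v
    using legal[OF that] by (simp add: laplacian_T_add)
  have h_legal: "0 \<le> D v - laplacian_T G h v" if v: "v \<in> verts G - {v0}" for v
  \<comment> \<open>\<open>h\<close> dominates \<open>k - R\<close> and agrees with it where
    \<open>R v \<le> k v\<close>; elsewhere \<open>h\<close> vanishes and \<open>D v \<ge> 0\<close>
    suffices.\<close>
  proof (cases "R v \<le> ?k v")
    case True
    then have "laplacian_T G h v \<le> laplacian_T G (\<lambda>u. ?k u - R u) v"
      by (intro laplacian_T_antimono) (auto simp: h_def)
    also have "\<dots> = laplacian_T G ?k v"
      using R_kernel[of v] v by (simp add: laplacian_T_diff)
    finally show ?thesis using k_legal[OF v] by simp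
  next
    case False
    then have "laplacian_T G h v \<le> 0"
      by (intro laplacian_T_nonpos) (auto simp: h_def)
    then show ?thesis using D_nonneg[OF v] by simp
  qed
  have "\<not> valid_firing G v0 R h"
    using not_reducedI[of G v0 R h D] h_legal red by blast
  moreover have "h v0 = 0"
    using run_le_R[OF t', of v0] g_v0 by (simp add: h_def)
  \<comment> \<open>Both \<open>f t\<close> and \<open>g\<close> are at most \<open>R\<close>, so
    \<open>k - R \<le> R\<close>.\<close>
  moreover have "0 \<le> h u \<and> h u \<le> R u" if "u \<in> verts G" for u
    using run_le_R[OF t', of u] g_le[OF that] R_pos[OF that] by (auto simp: h_def)
  ultimately have "h u = 0" if "u \<in> verts G" for u
    using that by (auto simp: valid_firing_def)
  then have k_le: "?k u \<le> R u" if "u \<in> verts G" for u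
    using that by (force simp: h_def)
  \<comment> \<open>\<open>k\<close> equals \<open>f t\<close> at \<open>v0\<close>, and the run is
    decreasing.\<close>
  have "?k v0 \<le> f s v0" if "s \<le> t" for s
    using run_decreasing[OF that t', of v0] g_v0 by simp
  then have "?k u \<le> f t u" if "u \<in> verts G" for u
    using run_bounded_below[of ?k t u] k_le k_legal t' that by blast
  then show False using valid by (force simp: valid_firing_def)
qed

end

theorem theorem3p11:
  fixes G :: "('a, 'b) pre_digraph" and v0 :: 'a
    and R D :: "'a \<Rightarrow> int" and f :: "nat \<Rightarrow> 'a \<Rightarrow> int" and N :: enat
  assumes "fin_digraph G" and "loopfree_digraph G" and "strongly_connected G"
    and "v0 \<in> verts G"
    and "primitive_kernel_vector G R"
    and "\<forall>v\<in>verts G - {v0}. D v \<ge> 0"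
    and "dhar_run G v0 R D f N"
  shows "(reduced G v0 R D \<longleftrightarrow>
            N = enat (nat (\<Sum>v\<in>verts G. R v)) \<and>
            (\<forall>v\<in>verts G. f (nat (\<Sum>v\<in>verts G. R v)) v = 0)) \<and>
         (reduced G v0 R D \<longrightarrow>
            (\<forall>t < nat (\<Sum>v\<in>verts G. R v).
               f (Suc t) = f t - indicator {v0} \<longrightarrow>
               reduced G v0 R (D - laplacian_T G (f t))))"
proof -
  interpret fin_digraph G by fact
  interpret dhar_execution G v0 R D f N
    using assms(4-7) by unfold_locales (auto simp: primitive_kernel_vector_def)
  show ?thesis
    \<comment> \<open>In (ii), reducedness of \<open>D\<close> identifies \<open>N\<close> with the
      total of \<open>R\<close>, so every \<open>t\<close> below that total is the time of an actual
      step.\<close>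
    using reduced_terminates_at_zero reduced_if_reaches_zero reduced_at_root_step by auto
qed

end
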